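(* Let $M$ be a unital Rickart $C^*$-algebra, let $\mathcal J$ be a norm-closed two-sided ideal of $M$, and let $C$ be a masa of $\mathcal J$ which contains an increasing sequence of projections whose least upper bound in $M$ is $1_M$. Then $C'\cap M$ is the sequentially monotone closure of $C$ in the following sense: every $0\le a\in C'\cap M$ is the least upper bound in $M_h$ of some increasing sequence of positive elements from $\mathcal J$.
   Context: A Rickart $C^*$-algebra is a $C^*$-algebra $M$ in which the right annihilator of every single element is of the form $eM$ with $e\in M$ a projection (self-adjoint idempotent). $M_h$ is the ordered real vector space of self-adjoint elements of $M$. For an increasing sequence of projections in a Rickart $C^*$-algebra $M$, its least upper bound in the projection lattice of $M$ exists and coincides with its least upper bound in $M_h$. A masa is a maximal abelian self-adjoint subalgebra. $C'\cap M$ denotes the set of elements of $M$ commuting with every element of $C$. *)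

theory Defs
  imports Complex_Main
begin

text \<open>
  The zero algebra is not excluded: the class \<^class>\<open>real_normed_algebra\<close> is combined below with
  \<^class>\<open>monoid_mult\<close>, which adds a unit without requiring it to differ from zero (in a nonzero
  algebra, the C*-identity forces the unit to have norm 1).
\<close>

class cstar_algebra = real_normed_algebra + banach +
  fixes scaleC :: "complex \<Rightarrow> 'a \<Rightarrow> 'a" (infixr "*\<^sub>C" 75)
    and star :: "'a \<Rightarrow> 'a"
  assumes scaleC_add_right: "c *\<^sub>C (x + y) = c *\<^sub>C x + c *\<^sub>C y"
    and scaleC_add_left: "(c + d) *\<^sub>C x = c *\<^sub>C x + d *\<^sub>C x"
    and scaleC_scaleC: "c *\<^sub>C (d *\<^sub>C x) = (c * d) *\<^sub>C x"
    and scaleC_complex_of_real: "complex_of_real r *\<^sub>C x = r *\<^sub>R x"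
    and norm_scaleC: "norm (c *\<^sub>C x) = cmod c * norm x"
    and mult_scaleC_left: "(c *\<^sub>C x) * y = c *\<^sub>C (x * y)"
    and mult_scaleC_right: "x * (c *\<^sub>C y) = c *\<^sub>C (x * y)"
    and star_star: "star (star x) = x"
    and star_add: "star (x + y) = star x + star y"
    and star_scaleC: "star (c *\<^sub>C x) = cnj c *\<^sub>C star x"
    and star_mult: "star (x * y) = star y * star x"
    and cstar_identity: "norm (star x * x) = (norm x)\<^sup>2"
begin

definition self_adjoint :: "'a \<Rightarrow> bool" where
  "self_adjoint x \<longleftrightarrow> star x = x"

definition projection :: "'a \<Rightarrow> bool" where
  "projection e \<longleftrightarrow> self_adjoint e \<and> e * e = e"

definition right_annihilator :: "'a \<Rightarrow> 'a set" where
  "right_annihilator x = {y. x * y = 0}"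

definition complex_subspace :: "'a set \<Rightarrow> bool" where
  "complex_subspace S \<longleftrightarrow>
     0 \<in> S \<and> (\<forall>x\<in>S. \<forall>y\<in>S. x + y \<in> S) \<and> (\<forall>c. \<forall>x\<in>S. c *\<^sub>C x \<in> S)"

definition two_sided_ideal :: "'a set \<Rightarrow> bool" where
  "two_sided_ideal J \<longleftrightarrow>
     complex_subspace J \<and> (\<forall>x. \<forall>y\<in>J. x * y \<in> J \<and> y * x \<in> J)"

definition abelian_star_subalgebra :: "'a set \<Rightarrow> bool" where
  "abelian_star_subalgebra C \<longleftrightarrow>
     complex_subspace C \<and> (\<forall>x\<in>C. star x \<in> C) \<and>
     (\<forall>x\<in>C. \<forall>y\<in>C. x * y \<in> C \<and> x * y = y * x)"

definition masa_of :: "'a set \<Rightarrow> 'a set \<Rightarrow> bool" where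
  "masa_of J C \<longleftrightarrow>
     C \<subseteq> J \<and> abelian_star_subalgebra C \<and>
     (\<forall>D. D \<subseteq> J \<longrightarrow> abelian_star_subalgebra D \<longrightarrow> C \<subseteq> D \<longrightarrow> D = C)"

definition commutant :: "'a set \<Rightarrow> 'a set" where
  "commutant C = {x. \<forall>c\<in>C. x * c = c * x}"

end

class rickart_cstar_algebra = cstar_algebra +
  assumes rickart: "\<exists>e. projection e \<and> right_annihilator x = range (\<lambda>y. e * y)"

definition spectrum :: "'a::{cstar_algebra, monoid_mult} \<Rightarrow> complex set" where
  "spectrum x =
     {c. \<not> (\<exists>y. (c *\<^sub>C 1 - x) * y = 1 \<and> y * (c *\<^sub>C 1 - x) = 1)}"

definition positive :: "'a::{cstar_algebra, monoid_mult} \<Rightarrow> bool" where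
  "positive x \<longleftrightarrow> self_adjoint x \<and> spectrum x \<subseteq> complex_of_real ` {0..}"

definition cstar_le :: "'a::{cstar_algebra, monoid_mult} \<Rightarrow> 'a \<Rightarrow> bool" where
  "cstar_le x y \<longleftrightarrow> positive (y - x)"

text \<open>The sequence itself is not required to consist of self-adjoint elements, but this holds
  automatically whenever it has a least upper bound in this sense.\<close>

definition is_lub_self_adjoint :: "(nat \<Rightarrow> 'a::{cstar_algebra, monoid_mult}) \<Rightarrow> 'a \<Rightarrow> bool" where
  "is_lub_self_adjoint f u \<longleftrightarrow>
     self_adjoint u \<and> (\<forall>n. cstar_le (f n) u) \<and>
     (\<forall>v. self_adjoint v \<longrightarrow> (\<forall>n. cstar_le (f n) v) \<longrightarrow> cstar_le u v)"

end

theory Submission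
  imports Defs "HOL-Analysis.Topology_Euclidean_Space"
begin

text \<open>
  The approximating sequence is \<open>p\<^sub>n a\<close>. If \<open>v\<close> is self-adjoint with \<open>p\<^sub>n a \<le> v\<close> for all \<open>n\<close>
  and \<open>a \<le> K\<close>, then \<open>a - v \<le> (1 - p\<^sub>n) a \<le> K (1 - p\<^sub>n)\<close>, that is \<open>p\<^sub>n \<le> 1 + (v - a) / K\<close>;
  since the \<open>p\<^sub>n\<close> have least upper bound \<open>1\<close>, this gives \<open>a \<le> v\<close>. The analytic input is that
  the positive elements, defined through the spectrum, are closed under addition, which rests on the
  norm of a self-adjoint element being at most its spectral radius.
\<close>

section \<open>Involution and unit\<close>

lemma star_zero [simp]: "star (0::'a::cstar_algebra) = 0"
  using star_add[of "0::'a" 0] by simp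

lemma star_minus [simp]: "star (- x) = - star (x::'a::cstar_algebra)"
  using star_add[of x "- x"] by (simp add: add_eq_0_iff)

lemma star_diff: "star (x - y) = star x - star (y::'a::cstar_algebra)"
  using star_add[of x "- y"] by simp

lemma star_scaleR: "star (r *\<^sub>R x) = r *\<^sub>R star (x::'a::cstar_algebra)"
  using star_scaleC[of "complex_of_real r" x] by (simp add: scaleC_complex_of_real)

lemma scaleC_one [simp]: "1 *\<^sub>C x = (x::'a::cstar_algebra)"
  using scaleC_complex_of_real[of 1 x] by simp

lemma scaleC_minus_left: "(- c) *\<^sub>C x = - (c *\<^sub>C (x::'a::cstar_algebra))"
proof -
  have "(- c) *\<^sub>C x + c *\<^sub>C x = 0 *\<^sub>C x"
    by (simp flip: scaleC_add_left)
  also have "\<dots> = 0" using scaleC_complex_of_real[of 0 x] by simp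
  finally show ?thesis by (simp add: add_eq_0_iff2)
qed

lemma scaleC_diff_left: "(c - d) *\<^sub>C x = c *\<^sub>C x - d *\<^sub>C (x::'a::cstar_algebra)"
  using scaleC_add_left[of c "- d" x] by (simp add: scaleC_minus_left)

lemma scaleC_zero_right [simp]: "c *\<^sub>C 0 = (0::'a::cstar_algebra)"
  using scaleC_add_right[of c "0::'a" 0] by simp

lemma scaleC_diff_right: "c *\<^sub>C (x - y) = c *\<^sub>C x - c *\<^sub>C (y::'a::cstar_algebra)"
  using scaleC_add_right[of c "x - y" y] by (simp add: algebra_simps)

lemma star_one [simp]: "star (1::'a::{cstar_algebra, monoid_mult}) = 1"
  by (metis mult_1_left mult_1_right star_mult star_star)

text \<open>The C*-identity makes the norm of 1 a root of \<open>t = t * t\<close>, hence 0 or 1.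
  Only an inequality can be claimed, since the zero algebra is allowed.\<close>

lemma norm_one_le: "norm (1::'a::{cstar_algebra, monoid_mult}) \<le> 1"
  using cstar_identity[of "1::'a"] by (auto simp: power2_eq_square)

lemma self_adjoint_add: "self_adjoint x \<Longrightarrow> self_adjoint y \<Longrightarrow> self_adjoint (x + y)"
  by (simp add: self_adjoint_def star_add)

lemma self_adjoint_diff: "self_adjoint x \<Longrightarrow> self_adjoint y \<Longrightarrow> self_adjoint (x - y)"
  by (simp add: self_adjoint_def star_diff)

lemma self_adjoint_scaleR: "self_adjoint x \<Longrightarrow> self_adjoint (r *\<^sub>R x)"
  by (simp add: self_adjoint_def star_scaleR)

lemma self_adjoint_one: "self_adjoint (1::'a::{cstar_algebra, monoid_mult})"
  by (simp add: self_adjoint_def)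

lemma self_adjoint_mult:
  "self_adjoint x \<Longrightarrow> self_adjoint y \<Longrightarrow> x * y = y * x \<Longrightarrow> self_adjoint (x * y)"
  by (simp add: self_adjoint_def star_mult)

lemma self_adjoint_power:
  "self_adjoint (x::'a::{cstar_algebra, monoid_mult}) \<Longrightarrow> self_adjoint (x ^ n)"
proof (induction n)
  case (Suc n)
  then show ?case by (simp add: self_adjoint_mult power_commutes)
qed (simp add: self_adjoint_one)

lemma norm_self_adjoint_square: "self_adjoint x \<Longrightarrow> norm (x * x) = (norm x)\<^sup>2"
  using cstar_identity[of x] by (simp add: self_adjoint_def)

text \<open>Iterated C*-identity. It prevents the norm of a normalised self-adjoint element from
  decaying under repeated squaring.\<close>

lemma norm_self_adjoint_power_power2:
  fixes x :: "'a::{cstar_algebra, monoid_mult}"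
  assumes "self_adjoint x"
  shows "norm (x ^ (2 ^ n)) = norm x ^ (2 ^ n)"
proof (induction n)
  case (Suc n)
  have "norm (x ^ (2 ^ Suc n)) = norm (x ^ (2 ^ n) * x ^ (2 ^ n))"
    by (simp add: mult_2 power_add)
  also have "\<dots> = (norm (x ^ (2 ^ n)))\<^sup>2"
    by (rule norm_self_adjoint_square[OF self_adjoint_power[OF assms]])
  finally show ?case using Suc by (simp add: power2_eq_square mult_2 power_add)
qed simp


section \<open>Inverses and spectra\<close>

definition inverse_of :: "'a::monoid_mult \<Rightarrow> 'a \<Rightarrow> bool" where
  "inverse_of y x \<longleftrightarrow> x * y = 1 \<and> y * x = 1"

lemma spectrum_iff: "c \<in> spectrum x \<longleftrightarrow> (\<nexists>y. inverse_of y (c *\<^sub>C 1 - x))"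
  by (simp add: spectrum_def inverse_of_def)

lemma inverse_of_mult:
  assumes "inverse_of y x" "inverse_of w v"
  shows "inverse_of (w * y) (x * v)"
  using assms unfolding inverse_of_def by (metis mult.assoc mult_1_left)

lemma inverse_of_commute:
  assumes "inverse_of y x" "g * x = x * g"
  shows "g * y = y * g"
  using assms unfolding inverse_of_def by (metis mult.assoc mult_1_left mult_1_right)

lemma inverse_of_scaleC:
  fixes x :: "'a::{cstar_algebra, monoid_mult}"
  assumes "inverse_of y x" "c \<noteq> 0"
  shows "inverse_of ((1 / c) *\<^sub>C y) (c *\<^sub>C x)"
  using assms by (simp add: inverse_of_def mult_scaleC_left mult_scaleC_right scaleC_scaleC)

text \<open>A right and a left inverse arise as the Banach fixed points of
  \<open>1 + x * y = y\<close> and \<open>1 + z * x = z\<close>; having both, they coincide. The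
  norm bound comes from the first equation.\<close>

lemma neumann_inverse:
  fixes x :: "'a::{cstar_algebra, monoid_mult}"
  assumes "norm x < 1"
  obtains y where "inverse_of y (1 - x)" "norm y \<le> 1 / (1 - norm x)"
proof -
  have "dist (1 + x * y) (1 + x * z) \<le> norm x * dist y z" for y z
    by (simp add: dist_norm norm_mult_ineq flip: right_diff_distrib)
  hence "\<exists>!y. 1 + x * y = y"
    using assms by (intro banach_fix_type[where c = "norm x"]) auto
  then obtain y where y: "1 + x * y = y" by auto
  have "dist (1 + y * x) (1 + z * x) \<le> norm x * dist y z" for y z
    using norm_mult_ineq[of "y - z" x]
    by (simp add: dist_norm mult.commute[of "norm x"] flip: left_diff_distrib)
  hence "\<exists>!z. 1 + z * x = z"
    using assms by (intro banach_fix_type[where c = "norm x"]) auto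
  then obtain z where z: "1 + z * x = z" by auto
  have r: "(1 - x) * y = 1" using y by (simp add: algebra_simps)
  have l: "z * (1 - x) = 1" using z by (simp add: algebra_simps)
  have "z = y" using r l by (metis mult.assoc mult_1_left mult_1_right)
  moreover have "norm y \<le> 1 + norm x * norm y"
    using norm_triangle_ineq[of 1 "x * y"] norm_mult_ineq[of x y] norm_one_le[where 'a='a] y
    by simp
  hence "norm y \<le> 1 / (1 - norm x)"
    using assms by (simp add: field_simps)
  ultimately show thesis using that[of y] r l by (simp add: inverse_of_def)
qed

text \<open>If \<open>c\<close> exceeds \<open>norm x\<close> in modulus, then \<open>c - x\<close>
  is \<open>c\<close> times \<open>1 - x / c\<close>, which has a Neumann inverse.\<close>

lemma spectrum_norm_le:
  fixes x :: "'a::{cstar_algebra, monoid_mult}"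
  assumes "c \<in> spectrum x"
  shows "cmod c \<le> norm x"
proof (rule ccontr)
  assume "\<not> cmod c \<le> norm x"
  hence lt: "norm x < cmod c" and c: "c \<noteq> 0"
    using norm_ge_zero[of x] by (auto simp del: norm_ge_zero)
  have "norm ((1 / c) *\<^sub>C x) < 1"
    using lt c by (simp add: norm_scaleC norm_divide)
  then obtain y where "inverse_of y (1 - (1 / c) *\<^sub>C x)"
    by (rule neumann_inverse)
  from inverse_of_scaleC[OF this c] have "inverse_of ((1 / c) *\<^sub>C y) (c *\<^sub>C 1 - x)"
    using c by (simp add: scaleC_diff_right scaleC_scaleC)
  thus False using assms by (auto simp: spectrum_iff)
qed

lemma spectrum_shift:
  "c \<in> spectrum (x + d *\<^sub>C 1) \<longleftrightarrow> c - d \<in> spectrum x"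
  by (simp add: spectrum_iff scaleC_diff_left algebra_simps)

lemma spectrum_scaleC:
  assumes "d \<noteq> 0"
  shows "c \<in> spectrum (d *\<^sub>C x) \<longleftrightarrow> c / d \<in> spectrum x"
proof -
  have eq: "c *\<^sub>C 1 - d *\<^sub>C x = d *\<^sub>C ((c / d) *\<^sub>C 1 - x)"
    "(1 / d) *\<^sub>C (c *\<^sub>C 1 - d *\<^sub>C x) = (c / d) *\<^sub>C 1 - x"
    using assms by (simp_all add: scaleC_diff_right scaleC_scaleC)
  show ?thesis
    unfolding spectrum_iff
    using inverse_of_scaleC[of _ "(c / d) *\<^sub>C 1 - x" d]
      inverse_of_scaleC[of _ "c *\<^sub>C 1 - d *\<^sub>C x" "1 / d"] assms eq
    by (metis divide_eq_0_iff one_neq_zero)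
qed

text \<open>Arens' trick: shifting by \<open>i t\<close> moves a non-real spectral value faster than
  it increases the norm.\<close>

lemma spectrum_self_adjoint_real:
  fixes x :: "'a::{cstar_algebra, monoid_mult}"
  assumes sa: "self_adjoint x" and c: "c \<in> spectrum x"
  shows "Im c = 0"
proof (rule ccontr)
  assume im: "Im c \<noteq> 0"
  \<comment> \<open>The term t^2 occurs in both the squared modulus of \<open>c + d\<close> and the
    norm estimate. It cancels and leaves a bound on a nonconstant linear function of t, which is
    absurd.\<close>
  have bound: "2 * Im c * t \<le> (norm x)\<^sup>2" for t :: real
  proof -
    define d where "d = \<i> * complex_of_real t"
    have "c + d \<in> spectrum (x + d *\<^sub>C 1)"
      using c by (simp add: spectrum_shift)
    hence le: "cmod (c + d) \<le> norm (x + d *\<^sub>C 1)"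
      by (rule spectrum_norm_le)
    have "star (x + d *\<^sub>C 1) * (x + d *\<^sub>C 1) = x * x + (t\<^sup>2) *\<^sub>R 1"
      using sa scaleC_complex_of_real[of "t\<^sup>2" "1::'a"]
      by (simp add: star_add star_scaleC self_adjoint_def distrib_left distrib_right
          mult_scaleC_left mult_scaleC_right scaleC_scaleC d_def scaleC_minus_left
          scaleC_diff_right power2_eq_square algebra_simps)
    hence "(norm (x + d *\<^sub>C 1))\<^sup>2 = norm (x * x + (t\<^sup>2) *\<^sub>R (1::'a))"
      by (metis cstar_identity)
    also have "\<dots> \<le> (norm x)\<^sup>2 + t\<^sup>2 * norm (1::'a)"
      using norm_triangle_ineq[of "x * x" "(t\<^sup>2) *\<^sub>R (1::'a)"] norm_self_adjoint_square[OF sa]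
      by simp
    also have "\<dots> \<le> (norm x)\<^sup>2 + t\<^sup>2"
      using mult_left_mono[OF norm_one_le[where 'a='a], of "t\<^sup>2"] by simp
    finally have "(cmod (c + d))\<^sup>2 \<le> (norm x)\<^sup>2 + t\<^sup>2"
      using power_mono[OF le norm_ge_zero, of 2] by linarith
    moreover have "(cmod (c + d))\<^sup>2 = (Re c)\<^sup>2 + (Im c + t)\<^sup>2"
      by (simp add: cmod_power2 d_def)
    ultimately have "(Re c)\<^sup>2 + (Im c)\<^sup>2 + 2 * Im c * t \<le> (norm x)\<^sup>2"
      by (simp add: power2_sum)
    thus ?thesis using zero_le_power2[of "Re c"] zero_le_power2[of "Im c"] by linarith
  qed
  show False
    \<comment> \<open>With this t the left side of \<open>bound\<close> is its right side plus
      1.\<close>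
    using bound[of "((norm x)\<^sup>2 + 1) / (2 * Im c)"] im by simp
qed


section \<open>The spectral radius of a self-adjoint element\<close>

text \<open>\<open>koebe_bound g B\<close> bounds \<open>F(zg)\<close> on the unit circle, for \<open>F(w) = w / (1 - w)\<^sup>2\<close>.
  Since \<open>F(w) + F(-w) = 4 F(w\<^sup>2)\<close>, passing from \<open>g\<close> to \<open>g\<^sup>2\<close> halves the bound.\<close>

definition koebe_bound :: "'a::{cstar_algebra, monoid_mult} \<Rightarrow> real \<Rightarrow> bool" where
  "koebe_bound g B \<longleftrightarrow>
     (\<forall>z. cmod z = 1 \<longrightarrow>
       (\<exists>y. inverse_of y (1 - z *\<^sub>C g) \<and> norm ((z *\<^sub>C g) * y * y) \<le> B))"

text \<open>With u the inverse of \<open>1 - g * g\<close>, one has \<open>y = u + u * g\<close> and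
  \<open>w = u - u * g\<close>. As everything commutes, the difference is g u^2 ((1 + g)^2 - (1 -
  g)^2) = 4 g^2 u^2.\<close>

lemma koebe_duplication:
  fixes g :: "'a::{cstar_algebra, monoid_mult}"
  assumes y: "inverse_of y (1 - g)" and w: "inverse_of w (1 + g)"
  shows "inverse_of (w * y) (1 - g * g)"
    and "4 *\<^sub>R (g * g * (w * y) * (w * y)) = g * y * y - g * w * w"
proof -
  define u where "u = w * y"
  have "(1 - g) * (1 + g) = 1 - g * g" by (simp add: algebra_simps)
  thus inv: "inverse_of (w * y) (1 - g * g)"
    using inverse_of_mult[OF y w] by simp
  have gu: "g * u = u * g"
    using inverse_of_commute[OF inv, of g] by (simp add: u_def algebra_simps)
  have gu': "g * (u * x) = u * (g * x)" for x
    using gu by (metis mult.assoc)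
  have gy: "g * y = y * g"
    using inverse_of_commute[OF y, of g] by (simp add: algebra_simps)
  have "u * (1 - g) = w"
    using y by (simp add: u_def inverse_of_def mult.assoc)
  hence w_eq: "w = u - u * g" by (simp add: algebra_simps)
  have "u * (1 + g) = w * (1 + g) * y" using gy by (simp add: u_def algebra_simps)
  hence "u * (1 + g) = y"
    using w by (simp add: inverse_of_def)
  hence y_eq: "y = u + u * g" by (simp add: algebra_simps)
  have "g * y * y - g * w * w
      = (g * g * u * u + g * g * u * u) + (g * g * u * u + g * g * u * u)"
    unfolding w_eq y_eq by (simp add: algebra_simps gu gu')
  also have "\<dots> = 4 *\<^sub>R (g * g * u * u)"
    by (simp flip: scaleR_2 scaleR_left_distrib)
  finally show "4 *\<^sub>R (g * g * (w * y) * (w * y)) = g * y * y - g * w * w"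
    by (simp add: u_def)
qed

text \<open>Both square roots s and -s of z lie on the unit circle, so the two terms of the
  duplication formula have norm at most B each, and dividing by 4 leaves B / 2.\<close>

lemma koebe_bound_square:
  fixes g :: "'a::{cstar_algebra, monoid_mult}"
  assumes "koebe_bound g B"
  shows "koebe_bound (g * g) (B / 2)"
  unfolding koebe_bound_def
proof (intro allI impI)
  fix z :: complex
  assume z: "cmod z = 1"
  define s where "s = csqrt z"
  have s: "s * s = z" by (simp add: s_def flip: power2_eq_square)
  have ns: "cmod s = 1" using z by (simp add: s_def)
  obtain y where y: "inverse_of y (1 - s *\<^sub>C g)" "norm ((s *\<^sub>C g) * y * y) \<le> B"
    using assms ns unfolding koebe_bound_def by blast
  have "cmod (- s) = 1" using ns by simp
  then obtain w where "inverse_of w (1 - (- s) *\<^sub>C g)" "norm (((- s) *\<^sub>C g) * w * w) \<le> B"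
    using assms unfolding koebe_bound_def by blast
  hence w: "inverse_of w (1 + s *\<^sub>C g)" "norm ((s *\<^sub>C g) * w * w) \<le> B"
    by (simp_all add: scaleC_minus_left)
  have sq: "(s *\<^sub>C g) * (s *\<^sub>C g) = z *\<^sub>C (g * g)"
    by (simp add: mult_scaleC_left mult_scaleC_right scaleC_scaleC s)
  note dup = koebe_duplication[OF y(1) w(1), unfolded sq]
  have "4 * norm (z *\<^sub>C (g * g) * (w * y) * (w * y))
      = norm ((s *\<^sub>C g) * y * y - (s *\<^sub>C g) * w * w)"
    by (simp flip: dup(2))
  also have "\<dots> \<le> B + B"
    using norm_triangle_ineq4[of "(s *\<^sub>C g) * y * y" "(s *\<^sub>C g) * w * w"] y(2) w(2) by linarith
  finally have "norm (z *\<^sub>C (g * g) * (w * y) * (w * y)) \<le> B / 2" by simp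
  thus "\<exists>y. inverse_of y (1 - z *\<^sub>C (g * g)) \<and> norm (z *\<^sub>C (g * g) * y * y) \<le> B / 2"
    using dup(1) by blast
qed

lemma koebe_bound_power:
  assumes "koebe_bound g B"
  shows "koebe_bound (g ^ (2 ^ n)) (B / 2 ^ n)"
proof (induction n)
  case (Suc n)
  have "g ^ (2 ^ Suc n) = g ^ (2 ^ n) * g ^ (2 ^ n)" by (simp add: mult_2 power_add)
  moreover have "B / 2 ^ Suc n = B / 2 ^ n / 2" by simp
  ultimately show ?case using koebe_bound_square[OF Suc] by (simp only:)
qed (use assms in simp)

text \<open>At z = 1 the element g is recovered as F(g) (1 - g)^2, where the second factor has norm
  at most 4.\<close>

lemma koebe_bound_norm:
  fixes g :: "'a::{cstar_algebra, monoid_mult}"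
  assumes "koebe_bound g B" "norm g \<le> 1"
  shows "norm g \<le> 4 * B"
proof -
  obtain y where y: "inverse_of y (1 - g)" "norm (g * y * y) \<le> B"
    using assms(1) unfolding koebe_bound_def by (metis norm_one scaleC_one)
  have "g * y * y * ((1 - g) * (1 - g)) = g * y * (y * (1 - g)) * (1 - g)"
    by (simp only: mult.assoc)
  also have "\<dots> = g"
    using y(1) by (simp add: inverse_of_def mult.assoc)
  finally have "norm g \<le> norm (g * y * y) * norm ((1 - g) * (1 - g))"
    using norm_mult_ineq[of "g * y * y" "(1 - g) * (1 - g)"] by simp
  moreover have le: "norm (1 - g) \<le> 2"
    using norm_triangle_ineq4[of 1 g] norm_one_le[where 'a='a] assms(2) by linarith
  have "norm ((1 - g) * (1 - g)) \<le> 2 * 2"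
    using norm_mult_ineq[of "1 - g" "1 - g"] mult_mono[OF le le] by simp
  ultimately show ?thesis
    using mult_mono[OF y(2), of "norm ((1 - g) * (1 - g))" 4] order_trans[OF norm_ge_zero y(2)]
    by simp
qed

text \<open>The factorisation 1 - z' g = (1 - z g) (1 - (z' - z) y g) reduces nearby points to a
  Neumann inverse of norm at most 2.\<close>

lemma inverse_locally_bounded:
  fixes g :: "'a::{cstar_algebra, monoid_mult}"
  assumes inv: "inverse_of y (1 - z *\<^sub>C g)"
  shows "\<exists>e>0. \<forall>z'\<in>ball z e. \<exists>y'. inverse_of y' (1 - z' *\<^sub>C g) \<and> norm y' \<le> 2 * norm y"
proof -
  \<comment> \<open>Adding 1 keeps the radius \<open>1 / (2 * L)\<close> meaningful when
    \<open>y * g\<close> vanishes.\<close>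
  define L where "L = norm (y * g) + 1"
  have L: "L > 0" using norm_ge_zero[of "y * g"] unfolding L_def by linarith
  show ?thesis
  proof (intro exI[of _ "1 / (2 * L)"] conjI ballI)
    fix z'
    assume "z' \<in> ball z (1 / (2 * L))"
    hence zz: "cmod (z' - z) < 1 / (2 * L)" by (simp add: dist_norm norm_minus_commute)
    define x where "x = (z' - z) *\<^sub>C (y * g)"
    have "norm x \<le> cmod (z' - z) * L"
      by (simp add: x_def norm_scaleC L_def mult_left_mono)
    also have "\<dots> \<le> 1 / 2" using zz L by (simp add: field_simps)
    finally have x: "norm x \<le> 1 / 2" .
    then obtain v where v: "inverse_of v (1 - x)" "norm v \<le> 1 / (1 - norm x)"
      using neumann_inverse[of x] by auto
    have "1 / (1 - norm x) \<le> 2" using x by (simp add: field_simps)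
    hence v2: "norm v \<le> 2" using v(2) by linarith
    have "(1 - z *\<^sub>C g) * (1 - x) = (1 - z *\<^sub>C g) - (z' - z) *\<^sub>C ((1 - z *\<^sub>C g) * y * g)"
      by (simp add: x_def right_diff_distrib mult_scaleC_right mult.assoc)
    also have "\<dots> = 1 - z' *\<^sub>C g"
      using inv by (simp add: inverse_of_def scaleC_diff_left)
    finally have "inverse_of (v * y) (1 - z' *\<^sub>C g)"
      using inverse_of_mult[OF inv v(1)] by simp
    moreover have "norm (v * y) \<le> 2 * norm y"
      using norm_mult_ineq[of v y] mult_right_mono[OF v2, of "norm y"] by simp
    ultimately show "\<exists>y'. inverse_of y' (1 - z' *\<^sub>C g) \<and> norm y' \<le> 2 * norm y"
      by blast
  qed (use L in simp)
qed

text \<open>The inverses are locally bounded, so compactness of the unit circle gives one bound for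
  all of them, and hence for F(zg).\<close>

lemma koebe_bound_exists:
  fixes g :: "'a::{cstar_algebra, monoid_mult}"
  assumes "\<And>z. cmod z = 1 \<Longrightarrow> \<exists>y. inverse_of y (1 - z *\<^sub>C g)"
  obtains B where "koebe_bound g B"
proof -
  have "\<forall>z\<in>sphere 0 1. \<exists>e Y. e > 0 \<and>
      (\<forall>z'\<in>ball z e. \<exists>y'. inverse_of y' (1 - z' *\<^sub>C g) \<and> norm y' \<le> Y)"
  proof
    fix z :: complex
    assume "z \<in> sphere 0 1"
    then obtain y where "inverse_of y (1 - z *\<^sub>C g)" using assms by auto
    from inverse_locally_bounded[OF this]
    show "\<exists>e Y. e > 0 \<and> (\<forall>z'\<in>ball z e. \<exists>y'. inverse_of y' (1 - z' *\<^sub>C g) \<and> norm y' \<le> Y)"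
      by blast
  qed
  from bchoice[OF this] obtain e where "\<forall>z\<in>sphere 0 1. \<exists>Y. e z > 0 \<and>
      (\<forall>z'\<in>ball z (e z). \<exists>y'. inverse_of y' (1 - z' *\<^sub>C g) \<and> norm y' \<le> Y)" ..
  from bchoice[OF this] obtain Y where eY: "\<And>z. z \<in> sphere 0 1 \<Longrightarrow> e z > 0"
      "\<And>z z'. z \<in> sphere 0 1 \<Longrightarrow> z' \<in> ball z (e z) \<Longrightarrow>
        \<exists>y'. inverse_of y' (1 - z' *\<^sub>C g) \<and> norm y' \<le> Y z"
    by blast
  have "sphere 0 1 \<subseteq> (\<Union>z\<in>sphere 0 1. ball z (e z))"
    using eY(1) by (meson UN_I centre_in_ball subsetI)
  then obtain T where T: "T \<subseteq> sphere 0 1" "finite T" "sphere 0 1 \<subseteq> (\<Union>z\<in>T. ball z (e z))"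
    by (rule compactE_image[OF compact_sphere open_ball])
  \<comment> \<open>The absolute values make all summands nonnegative, so the finite sum dominates
    each local bound.\<close>
  define K where "K = (\<Sum>z\<in>T. \<bar>Y z\<bar>)"
  have "koebe_bound g (norm g * K * K)"
    unfolding koebe_bound_def
  proof (intro allI impI)
    fix z :: complex
    assume z: "cmod z = 1"
    then obtain t where t: "t \<in> T" "z \<in> ball t (e t)" using T(3) by force
    then obtain y where y: "inverse_of y (1 - z *\<^sub>C g)" "norm y \<le> Y t"
      using eY(2) T(1) by blast
    have "\<bar>Y t\<bar> \<le> K"
      unfolding K_def using T(2) t(1) by (intro member_le_sum) auto
    hence yK: "norm y \<le> K" using y(2) by linarith
    have "norm (z *\<^sub>C g * y * y) \<le> norm (z *\<^sub>C g) * norm y * norm y"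
      by (meson mult_right_mono norm_ge_zero norm_mult_ineq order_trans)
    also have "\<dots> \<le> norm g * K * K"
      using yK z order_trans[OF norm_ge_zero yK]
      by (auto simp: norm_scaleC intro!: mult_mono mult_nonneg_nonneg)
    finally show "\<exists>y. inverse_of y (1 - z *\<^sub>C g) \<and> norm (z *\<^sub>C g * y * y) \<le> norm g * K * K"
      using y(1) by blast
  qed
  thus thesis by (rule that)
qed

text \<open>If r were smaller than \<open>norm h\<close>, the normalised g would have
  \<open>1 - z g\<close> invertible on the whole unit circle, giving a Koebe bound B. Squaring n
  times keeps the norm equal to 1 but shrinks the bound to B / 2^n, against
  \<open>koebe_bound_norm\<close>.\<close>

lemma norm_le_spectral_bound:
  fixes h :: "'a::{cstar_algebra, monoid_mult}"
  assumes sa: "self_adjoint h" and r: "r \<ge> 0" and spec: "\<And>c. c \<in> spectrum h \<Longrightarrow> cmod c \<le> r"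
  shows "norm h \<le> r"
proof (rule ccontr)
  assume "\<not> norm h \<le> r"
  hence lt: "r < norm h" and pos: "norm h > 0" using r by auto
  define g where "g = (1 / norm h) *\<^sub>R h"
  have ng: "norm g = 1" using pos by (simp add: g_def)
  have sg: "self_adjoint g" unfolding g_def by (rule self_adjoint_scaleR[OF sa])
  have "\<exists>y. inverse_of y (1 - z *\<^sub>C g)" if z: "cmod z = 1" for z
  proof -
    \<comment> \<open>Chosen so that c - h = c (1 - z g), with c on the circle of radius
      \<open>norm h\<close>, which the spectrum misses.\<close>
    define c where "c = complex_of_real (norm h) / z"
    have "z \<noteq> 0" using z by auto
    hence c0: "c \<noteq> 0" using pos by (simp add: c_def)
    have "cmod c = norm h" using z by (simp add: c_def norm_divide)
    hence "c \<notin> spectrum h" using spec lt by force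
    then obtain y where "inverse_of y (c *\<^sub>C 1 - h)" by (auto simp: spectrum_iff)
    from inverse_of_scaleC[OF this, of "1 / c"] c0
    have "inverse_of (c *\<^sub>C y) (1 - (1 / c) *\<^sub>C h)"
      by (simp add: scaleC_diff_right scaleC_scaleC)
    moreover have "(1 / c) *\<^sub>C h = z *\<^sub>C g"
      by (simp add: g_def c_def scaleC_scaleC flip: scaleC_complex_of_real)
    ultimately show ?thesis by auto
  qed
  then obtain B where B: "koebe_bound g B" using koebe_bound_exists by blast
  have "1 \<le> 4 * (B / 2 ^ n)" for n
    using koebe_bound_norm[OF koebe_bound_power[OF B, of n]]
      norm_self_adjoint_power_power2[OF sg, of n] ng by simp
  hence le: "2 ^ n \<le> 4 * B" for n :: nat
    by (simp add: field_simps)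
  obtain n :: nat where "4 * B < 2 ^ n" using real_arch_pow[of 2 "4 * B"] by auto
  thus False using le[of n] by simp
qed


section \<open>The positive cone\<close>

text \<open>Spectral values of a self-adjoint element are real, so only the sign of the real part
  has to be checked.\<close>

lemma positive_iff:
  "positive x \<longleftrightarrow> self_adjoint x \<and> (\<forall>c\<in>spectrum x. Re c \<ge> 0)"
proof
  assume "positive x"
  thus "self_adjoint x \<and> (\<forall>c\<in>spectrum x. Re c \<ge> 0)"
    by (auto simp: positive_def)
next
  assume a: "self_adjoint x \<and> (\<forall>c\<in>spectrum x. Re c \<ge> 0)"
  have "c \<in> complex_of_real ` {0..}" if "c \<in> spectrum x" for c
  proof (rule image_eqI)
    show "c = complex_of_real (Re c)"
      using spectrum_self_adjoint_real[of x c] a that by (simp add: complex_eq_iff)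
  qed (use a that in simp)
  thus "positive x" using a by (auto simp: positive_def)
qed

text \<open>The spectrum lies between 0 and \<open>norm x\<close>, so the shifted one lies between
  \<open>- norm x\<close> and 0, and the spectral bound on the norm applies. Together with the
  converse below, this turns positivity into a norm inequality.\<close>

lemma norm_shift_positive_le:
  fixes x :: "'a::{cstar_algebra, monoid_mult}"
  assumes "positive x"
  shows "norm (x + (- norm x) *\<^sub>R 1) \<le> norm x"
proof (rule norm_le_spectral_bound)
  have sa: "self_adjoint x" using assms by (simp add: positive_iff)
  show "self_adjoint (x + (- norm x) *\<^sub>R 1)"
    by (intro self_adjoint_add sa self_adjoint_scaleR self_adjoint_one)
  fix c
  assume "c \<in> spectrum (x + (- norm x) *\<^sub>R 1)"
  hence c: "c + norm x \<in> spectrum x"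
    using spectrum_shift[of c x "complex_of_real (- norm x)"]
      scaleC_complex_of_real[of "- norm x" "1::'a"] by simp
  have im: "Im c = 0" using spectrum_self_adjoint_real[OF sa c] by simp
  have "0 \<le> Re (c + norm x)" using assms c by (simp only: positive_iff)
  moreover have "Re (c + norm x) \<le> norm x"
    using complex_Re_le_cmod spectrum_norm_le[OF c] by (rule order_trans)
  ultimately have "\<bar>Re c\<bar> \<le> norm x" by simp
  thus "cmod c \<le> norm x" using im by (simp add: cmod_eq_Re)
qed simp

lemma positive_if_norm_shift_le:
  fixes x :: "'a::{cstar_algebra, monoid_mult}"
  assumes sa: "self_adjoint x" and le: "norm (x + (- t) *\<^sub>R 1) \<le> t"
  shows "positive x"
  unfolding positive_iff
proof (intro conjI sa ballI)
  fix c
  assume "c \<in> spectrum x"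
  hence "c - t \<in> spectrum (x + (- t) *\<^sub>R 1)"
    using spectrum_shift[of "c - t" x "complex_of_real (- t)"]
      scaleC_complex_of_real[of "- t" "1::'a"] by simp
  hence "cmod (c - t) \<le> t" using spectrum_norm_le le order_trans by blast
  thus "Re c \<ge> 0" using abs_Re_le_cmod[of "c - t"] by simp
qed

text \<open>In the norm characterisation of positivity, with shift \<open>norm x + norm y\<close>,
  this is the triangle inequality.\<close>

lemma positive_add:
  fixes x y :: "'a::{cstar_algebra, monoid_mult}"
  assumes "positive x" "positive y"
  shows "positive (x + y)"
proof (rule positive_if_norm_shift_le)
  show "self_adjoint (x + y)"
    using assms by (simp add: positive_iff self_adjoint_add)
  have "x + y + (- (norm x + norm y)) *\<^sub>R 1
      = (x + (- norm x) *\<^sub>R 1) + (y + (- norm y) *\<^sub>R 1)"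
    by (simp add: algebra_simps)
  thus "norm (x + y + (- (norm x + norm y)) *\<^sub>R 1) \<le> norm x + norm y"
    using norm_triangle_mono[OF norm_shift_positive_le norm_shift_positive_le] assms by metis
qed

lemma positive_scaleR:
  fixes x :: "'a::{cstar_algebra, monoid_mult}"
  assumes "positive x" "r > 0"
  shows "positive (r *\<^sub>R x)"
  unfolding positive_iff
proof (intro conjI ballI)
  show "self_adjoint (r *\<^sub>R x)"
    using assms by (simp add: positive_iff self_adjoint_scaleR)
  fix c
  assume "c \<in> spectrum (r *\<^sub>R x)"
  hence "c / complex_of_real r \<in> spectrum x"
    using spectrum_scaleC[of "complex_of_real r" c x] assms
    by (simp add: scaleC_complex_of_real)
  hence "0 \<le> Re (c / complex_of_real r)" using assms by (simp only: positive_iff)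
  thus "0 \<le> Re c" using assms(2) by (simp add: zero_le_divide_iff)
qed

lemma positive_norm_diff:
  fixes x :: "'a::{cstar_algebra, monoid_mult}"
  assumes sa: "self_adjoint x" and le: "norm x \<le> t"
  shows "positive (t *\<^sub>R 1 - x)"
proof (rule positive_if_norm_shift_le[where t = t])
  show "self_adjoint (t *\<^sub>R 1 - x)"
    by (intro self_adjoint_diff self_adjoint_scaleR self_adjoint_one sa)
qed (use le in simp)

text \<open>Relative to the splitting 1 = q + (1 - q), the element \<open>q * a\<close> acts as a on
  the first part and as 0 on the second. Its spectrum therefore adds at most the point 0 to that of
  a.\<close>

lemma positive_projection_mult:
  fixes a q :: "'a::{cstar_algebra, monoid_mult}"
  assumes q: "projection q" and a: "positive a" and comm: "a * q = q * a"
  shows "positive (q * a)"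
  unfolding positive_iff
proof (intro conjI ballI)
  show "self_adjoint (q * a)"
    using q a comm by (intro self_adjoint_mult) (auto simp: projection_def positive_iff)
  have qq: "q * q = q" using q by (simp add: projection_def)
  fix c
  assume c: "c \<in> spectrum (q * a)"
  show "Re c \<ge> 0"
  proof (rule ccontr)
    assume neg: "\<not> Re c \<ge> 0"
    hence c0: "c \<noteq> 0" by auto
    have "c \<notin> spectrum a" using neg a by (auto simp: positive_iff)
    then obtain y where y: "inverse_of y (c *\<^sub>C 1 - a)" by (auto simp: spectrum_iff)
    have qy: "q * y = y * q"
      using inverse_of_commute[OF y, of q] comm
      by (simp add: algebra_simps mult_scaleC_left mult_scaleC_right)
    define d where "d = c *\<^sub>C 1 - a"
    define e where "e = 1 - q"
    have dq: "d * q = q * d"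
      using comm by (simp add: d_def algebra_simps mult_scaleC_left mult_scaleC_right)
    have dy: "d * y = 1" "y * d = 1" using y by (simp_all add: inverse_of_def d_def)
    have eq0: "e * q = 0" "q * e = 0" "e * e = e"
      by (simp_all add: e_def algebra_simps qq)
    have split: "c *\<^sub>C 1 - q * a = q * d + c *\<^sub>C e"
      by (simp add: d_def e_def algebra_simps mult_scaleC_right scaleC_diff_right)
    have qdqy: "(q * d) * (y * q) = q"
      by (metis dy(1) mult.assoc mult_1_left qq)
    have yqqd: "(y * q) * (q * d) = q"
      by (metis dy(2) dq mult.assoc mult_1_left qq)
    have qde: "(q * d) * e = 0" "e * (q * d) = 0"
      by (metis dq eq0(2) mult.assoc mult_zero_right) (metis eq0(1) mult.assoc mult_zero_left)
    have yqe: "(y * q) * e = 0" "e * (y * q) = 0"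
      by (metis eq0(2) mult.assoc mult_zero_right) (metis eq0(1) qy mult.assoc mult_zero_left)
    \<comment> \<open>The inverse is assembled blockwise: y inverts c - a on the q part, and 1 / c
      inverts c on the complement.\<close>
    have "inverse_of (y * q + (1 / c) *\<^sub>C e) (c *\<^sub>C 1 - q * a)"
      unfolding split inverse_of_def distrib_left distrib_right
        mult_scaleC_left mult_scaleC_right scaleC_scaleC qdqy yqqd qde yqe eq0
      using c0 by (simp add: e_def scaleC_scaleC)
    thus False using c by (auto simp: spectrum_iff)
  qed
qed

text \<open>If \<open>- e\<close> is positive then \<open>1 - e\<close> is invertible, but it is annihilated by \<open>e\<close>.\<close>

lemma projection_eq_0_if_minus_positive:
  fixes e :: "'a::{cstar_algebra, monoid_mult}"
  assumes e: "projection e" and neg: "positive (- e)"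
  shows "e = 0"
proof -
  have "- 1 \<notin> spectrum (- e)" using neg by (auto simp: positive_iff)
  then obtain y where "inverse_of y ((- 1) *\<^sub>C 1 - (- e))" by (auto simp: spectrum_iff)
  hence y: "(e - 1) * y = 1" by (simp add: inverse_of_def scaleC_minus_left)
  have "e * (e - 1) = 0" using e by (simp add: projection_def algebra_simps)
  thus "e = 0" using y by (metis mult.assoc mult_1_right mult_zero_left)
qed

section \<open>Order between commuting projections\<close>

lemma projection_one_minus:
  "projection (p::'a::{cstar_algebra, monoid_mult}) \<Longrightarrow> projection (1 - p)"
  by (simp add: projection_def self_adjoint_diff self_adjoint_one algebra_simps)

lemma projection_mult:
  fixes p q :: "'a::cstar_algebra"
  assumes "projection p" "projection q" "p * q = q * p"
  shows "projection (p * q)"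
  using assms unfolding projection_def
  by (metis mult.assoc self_adjoint_mult)

text \<open>Cutting the positive element q - p down by 1 - q gives the negative of the projection p
  (1 - q), which must then vanish.\<close>

lemma commuting_projections_le:
  fixes p q :: "'a::{cstar_algebra, monoid_mult}"
  assumes p: "projection p" and q: "projection q" and comm: "p * q = q * p"
    and le: "cstar_le p q"
  shows "p * q = p"
proof -
  have qq: "q * q = q" using q by (simp add: projection_def)
  have e: "projection (p * (1 - q))"
    using comm by (intro projection_mult projection_one_minus p q) (simp add: algebra_simps)
  have "positive ((1 - q) * (q - p))"
    using le comm qq
    by (intro positive_projection_mult projection_one_minus q)
      (simp_all add: cstar_le_def algebra_simps)
  also have "(1 - q) * (q - p) = - (p * (1 - q))"
    using comm qq by (simp add: algebra_simps)
  finally have "p * (1 - q) = 0"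
    using projection_eq_0_if_minus_positive[OF e] by simp
  thus ?thesis by (simp add: algebra_simps)
qed

lemma projection_diff:
  fixes p q :: "'a::cstar_algebra"
  assumes "projection p" "projection q" "p * q = p" "q * p = p"
  shows "projection (q - p)"
  using assms by (simp add: projection_def self_adjoint_diff algebra_simps)

section \<open>Suprema of positive elements cut down by projections\<close>

lemma is_lub_projections_mult:
  fixes p :: "nat \<Rightarrow> 'a::{cstar_algebra, monoid_mult}"
  assumes proj: "\<And>n. projection (p n)" and lub: "is_lub_self_adjoint p 1"
    and a: "positive a" and comm: "\<And>n. a * p n = p n * a"
  shows "is_lub_self_adjoint (\<lambda>n. p n * a) a"
  unfolding is_lub_self_adjoint_def
proof (intro conjI allI impI)
  show sa: "self_adjoint a" using a by (simp add: positive_iff)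
  show "cstar_le (p n * a) a" for n
  proof -
    have "positive ((1 - p n) * a)"
      using comm by (intro positive_projection_mult projection_one_minus proj a)
        (simp add: algebra_simps)
    thus ?thesis by (simp add: cstar_le_def algebra_simps)
  qed
  fix v
  assume v: "self_adjoint v" and ub: "\<forall>n. cstar_le (p n * a) v"
  \<comment> \<open>K dominates \<open>norm a\<close>, so K - a is positive; the added 1 allows
    division by K even for a = 0.\<close>
  define K where "K = norm a + 1"
  have K: "K > 0" using norm_ge_zero[of a] unfolding K_def by linarith
  \<comment> \<open>Designed so that K (w - p_n) = (v - p_n a) + (1 - p_n) (K - a), a sum of two
    positive elements. Thus w bounds all p_n, and 1 <= w says exactly that (v - a) / K is
    positive.\<close>
  define w where "w = 1 + (1 / K) *\<^sub>R (v - a)"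
  have "self_adjoint w"
    unfolding w_def
    by (intro self_adjoint_add self_adjoint_one self_adjoint_scaleR self_adjoint_diff v sa)
  moreover have "cstar_le (p n) w" for n
  proof -
    have "positive (K *\<^sub>R 1 - a)"
      by (rule positive_norm_diff[OF sa]) (simp add: K_def)
    hence "positive ((1 - p n) * (K *\<^sub>R 1 - a))"
      using comm by (intro positive_projection_mult projection_one_minus proj)
        (simp_all add: algebra_simps)
    moreover have "positive (v - p n * a)" using ub by (simp add: cstar_le_def)
    ultimately have "positive ((1 / K) *\<^sub>R ((v - p n * a) + (1 - p n) * (K *\<^sub>R 1 - a)))"
      using K by (intro positive_scaleR positive_add) auto
    also have "(v - p n * a) + (1 - p n) * (K *\<^sub>R 1 - a) = K *\<^sub>R (1 - p n) + (v - a)"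
      by (simp add: algebra_simps)
    also have "(1 / K) *\<^sub>R (K *\<^sub>R (1 - p n) + (v - a)) = w - p n"
      using K by (simp add: w_def scaleR_add_right)
    finally show ?thesis by (simp add: cstar_le_def)
  qed
  ultimately have "cstar_le 1 w" using lub by (simp add: is_lub_self_adjoint_def)
  hence "positive ((1 / K) *\<^sub>R (v - a))" by (simp add: cstar_le_def w_def)
  from positive_scaleR[OF this K] show "cstar_le a v"
    using K by (simp add: cstar_le_def)
qed

theorem mainTheorem6:
  fixes J C :: "'a::{rickart_cstar_algebra, monoid_mult} set"
  assumes "two_sided_ideal J" and "closed J"
    and "masa_of J C"
    and "\<exists>p::nat \<Rightarrow> 'a. (\<forall>n. p n \<in> C \<and> projection (p n)) \<and>
           monotone (\<le>) cstar_le p \<and> is_lub_self_adjoint p 1"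
  shows "\<forall>a \<in> commutant C. positive a \<longrightarrow>
           (\<exists>f::nat \<Rightarrow> 'a. (\<forall>n. f n \<in> J \<and> positive (f n)) \<and>
              monotone (\<le>) cstar_le f \<and> is_lub_self_adjoint f a)"
proof (intro ballI impI)
  fix a
  assume aC: "a \<in> commutant C" and a: "positive a"
  obtain p :: "nat \<Rightarrow> 'a" where pC: "\<And>n. p n \<in> C" and proj: "\<And>n. projection (p n)"
    and mono: "monotone (\<le>) cstar_le p" and lub: "is_lub_self_adjoint p 1"
    using assms(4) by blast
  have comm: "a * p n = p n * a" for n using aC pC by (simp add: commutant_def)
  have pJ: "p n \<in> J" for n using assms(3) pC by (auto simp: masa_of_def)
  have pp: "p m * p n = p n * p m" for m n
    using assms(3) pC unfolding masa_of_def abelian_star_subalgebra_def by blast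
  have "p n * a \<in> J" for n
    using assms(1) pJ by (simp add: two_sided_ideal_def)
  moreover have "positive (p n * a)" for n
    by (rule positive_projection_mult[OF proj a comm])
  moreover have "monotone (\<le>) cstar_le (\<lambda>n. p n * a)"
  proof (rule monotoneI)
    fix m n :: nat
    assume "m \<le> n"
    hence "cstar_le (p m) (p n)" using mono by (simp add: monotone_def)
    hence "p m * p n = p m" by (rule commuting_projections_le[OF proj proj pp])
    \<comment> \<open>The increment of the sequence is thereby a cut by a projection commuting with
      a, so its positivity follows as for the single terms.\<close>
    hence "projection (p n - p m)"
      using pp by (intro projection_diff proj) metis+
    hence "positive ((p n - p m) * a)"
      using a comm by (intro positive_projection_mult) (simp_all add: algebra_simps)
    thus "cstar_le (p m * a) (p n * a)" by (simp add: cstar_le_def algebra_simps)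
  qed
  ultimately show "\<exists>f::nat \<Rightarrow> 'a. (\<forall>n. f n \<in> J \<and> positive (f n)) \<and>
      monotone (\<le>) cstar_le f \<and> is_lub_self_adjoint f a"
    using is_lub_projections_mult[OF proj lub a comm]
    by (intro exI[of _ "\<lambda>n. p n * a"]) simp
qed

end
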